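(* Let $\varphi \in [0,2\pi]$ and encode a classical bit $c\in\{0,1\}$ as the qubit state $$|\chi_1\rangle = \tfrac{1}{\sqrt2}|0\rangle + e^{i\varphi}\tfrac{1}{\sqrt2}|1\rangle, \qquad |\chi_0\rangle = \tfrac{1}{\sqrt2}|0\rangle - e^{i\varphi}\tfrac{1}{\sqrt2}|1\rangle ,$$ i.e. using an orthonormal basis on the equator of the Bloch sphere. Let $n\ge 1$ be the current number of parties and let $$|X^{(n)}_1\rangle = \tfrac{1}{\sqrt2}|0\rangle^{\otimes n} + e^{i\varphi}\tfrac{1}{\sqrt2}|1\rangle^{\otimes n}, \qquad |X^{(n)}_0\rangle = \tfrac{1}{\sqrt2}|0\rangle^{\otimes n} - e^{i\varphi}\tfrac{1}{\sqrt2}|1\rangle^{\otimes n}$$ be the corresponding $n$-qubit states shared by the Q-TCSS scheme, the $i$-th party holding the $i$-th qubit. Then the resulting classical bit secret sharing scheme is perfect: for every proper subset $S \subsetneq \{1,\dots,n\}$ of parties, the reduced state held by $S$ does not depend on the shared bit, i.e. $$\mathrm{Tr}_{\{1,\dots,n\}\setminus S}\,|X^{(n)}_0\rangle\langle X^{(n)}_0| = \mathrm{Tr}_{\{1,\dots,n\}\setminus S}\,|X^{(n)}_1\rangle\langle X^{(n)}_1| .$$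
   Context: The Q-TCSS (quantum threshold changeable secret sharing) scheme shares a qubit $a|0\rangle + b|1\rangle$ with $|a|^2+|b|^2=1$ as follows. The dealer, and later any party holding one qubit of the shared state, may split a share by appending auxiliary qubits in state $|0\rangle$, applying controlled-NOT gates with the held qubit as control and each auxiliary qubit as target, and distributing the auxiliary qubits to new parties. Consequently, whenever the current total number of parties is $n$, they jointly hold $a|0\rangle^{\otimes n} + b|1\rangle^{\otimes n}$, one qubit per party. A classical bit is shared by encoding it as one of the two vectors of an orthonormal qubit basis and sharing that qubit with the Q-TCSS scheme. A basis on the equator of the Bloch sphere is one of the form $\frac{1}{\sqrt2}(|0\rangle \pm e^{i\varphi}|1\rangle)$. The state available to a subset $S$ of parties is the reduced density operator obtained by tracing out the qubits of the parties not in $S$; $\mathrm{Tr}_{\{1,\dots,n\}\setminus S}$ denotes this partial trace. The scheme is called perfect if any set of parties that is not the set of all current parties obtains no information about the shared bit, i.e. its reduced state is the same for both values of the bit (equivalently, every measurement by that set has the same outcome distribution for both values). *)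

theory Defs
  imports "HOL-Analysis.Finite_Product_Measure"
begin

text \<open>
  A single-qubit vector is given by its two amplitudes, with \<^term>\<open>False\<close> standing for the label
  0 and \<^term>\<open>True\<close> for the label 1.  The qubits of a register are indexed by the parties
  holding them, so that for a party set \<open>P\<close> the computational basis is labelled by the
  extensional functions from \<open>P\<close> to \<^typ>\<open>bool\<close>.  A vector (or an operator, as a matrix in the
  computational basis) on the register \<open>P\<close> is a function of such labels that is zero elsewhere;
  equality on the register is then equality of functions.
\<close>

type_synonym qubit = "bool \<Rightarrow> complex"
type_synonym 'p label = "'p \<Rightarrow> bool"
type_synonym 'p state = "'p label \<Rightarrow> complex"
type_synonym 'p oper = "'p label \<Rightarrow> 'p label \<Rightarrow> complex"

definition labels :: "'p set \<Rightarrow> 'p label set" where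
  "labels P = P \<rightarrow>\<^sub>E UNIV"

definition ket :: "bool \<Rightarrow> qubit" where
  "ket b = (\<lambda>d. if d = b then 1 else 0)"

definition tensor_power :: "'p set \<Rightarrow> qubit \<Rightarrow> 'p state" where
  "tensor_power P \<psi> = (\<lambda>x. if x \<in> labels P then \<Prod>i\<in>P. \<psi> (x i) else 0)"

definition projector :: "'p state \<Rightarrow> 'p oper" where
  "projector \<Psi> = (\<lambda>x y. \<Psi> x * cnj (\<Psi> y))"

text \<open>
  The trace over the qubits in \<open>T\<close> of an operator on the register \<open>P\<close> (with \<open>T \<subseteq> P\<close>), which is an
  operator on the register \<open>P - T\<close>.  Here \<^term>\<open>merge (P - T) T (x, z)\<close> is the label that
  agrees with \<open>x\<close> on \<open>P - T\<close> and with \<open>z\<close> on \<open>T\<close>.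
\<close>

definition partial_trace :: "'p set \<Rightarrow> 'p set \<Rightarrow> 'p oper \<Rightarrow> 'p oper" where
  "partial_trace P T \<rho> = (\<lambda>x y.
     if x \<in> labels (P - T) \<and> y \<in> labels (P - T)
     then \<Sum>z\<in>labels T. \<rho> (merge (P - T) T (x, z)) (merge (P - T) T (y, z))
     else 0)"

text \<open>
  The joint state \<open>a |0...0> + b |1...1>\<close> of the parties in \<open>P\<close> that share the qubit
  \<open>a |0> + b |1>\<close>.
\<close>

definition tcss_share :: "'p set \<Rightarrow> qubit \<Rightarrow> 'p state" where
  "tcss_share P q = (\<lambda>x. q False * tensor_power P (ket False) x
                         + q True * tensor_power P (ket True) x)"

definition equator_qubit :: "real \<Rightarrow> bool \<Rightarrow> qubit" where
  "equator_qubit \<phi> c = (\<lambda>d.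
     complex_of_real (1 / sqrt 2) * ket False d
     + (if c then 1 else -1) * cis \<phi> * complex_of_real (1 / sqrt 2) * ket True d)"

definition perfect_bit_sharing :: "'p set \<Rightarrow> (bool \<Rightarrow> 'p state) \<Rightarrow> bool" where
  "perfect_bit_sharing P X \<longleftrightarrow>
     (\<forall>S. S \<subset> P \<longrightarrow> partial_trace P (P - S) (projector (X False))
                  = partial_trace P (P - S) (projector (X True)))"

text \<open>
  The closed form of \<^const>\<open>tcss_share\<close> agrees with the way shares are split: party \<open>i\<close> appends an
  auxiliary qubit in state \<open>|0>\<close>, applies a controlled-NOT with its own qubit as control and the
  auxiliary qubit as target, and hands the auxiliary qubit to a new party \<open>j\<close>.
\<close>

definition append_zero :: "'p set \<Rightarrow> 'p \<Rightarrow> 'p state \<Rightarrow> 'p state" where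
  "append_zero P j \<Psi> = (\<lambda>x. if x \<in> labels (insert j P)
     then \<Psi> (restrict x P) * ket False (x j) else 0)"

definition cnot :: "'p \<Rightarrow> 'p \<Rightarrow> 'p state \<Rightarrow> 'p state" where
  "cnot i j \<Psi> = (\<lambda>x. \<Psi> (x(j := (x j \<noteq> x i))))"

lemma tensor_power_ket:
  assumes "finite P"
  shows "tensor_power P (ket b) x = (if x = (\<lambda>i\<in>P. b) then 1 else 0)"
proof (cases "x \<in> labels P")
  case True
  have "x = (\<lambda>i\<in>P. b) \<longleftrightarrow> (\<forall>i\<in>P. x i = b)"
    using True by (auto simp: labels_def fun_eq_iff restrict_def PiE_def extensional_def)
  then show ?thesis
    using True assms by (auto simp: tensor_power_def ket_def intro!: prod.neutral)
next
  case False
  then show ?thesis by (auto simp: tensor_power_def labels_def)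
qed

lemma tcss_share_single:
  "tcss_share {i} q x = (if x \<in> labels {i} then q (x i) else 0)"
  by (cases "x i") (auto simp: tcss_share_def tensor_power_def ket_def)

lemma tcss_share_split:
  assumes "finite P" "i \<in> P" "j \<notin> P"
  shows "cnot i j (append_zero P j (tcss_share P q)) = tcss_share (insert j P) q"
proof
  fix x :: "'a label"
  have ij: "i \<noteq> j" using assms by auto
  have mem: "x(j := b) \<in> labels (insert j P) \<longleftrightarrow> x \<in> labels (insert j P)" for b
    by (auto simp: labels_def PiE_def extensional_def)
  have res: "restrict (x(j := b)) P = restrict x P" for b
    using assms by (auto simp: restrict_def fun_eq_iff)
  have eq: "restrict x P = (\<lambda>k\<in>P. b) \<and> x j = x i \<longleftrightarrow> x = (\<lambda>k\<in>insert j P. b)"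
    if x: "x \<in> labels (insert j P)" for b
  proof
    assume L: "restrict x P = (\<lambda>k\<in>P. b) \<and> x j = x i"
    have P: "x k = b" if "k \<in> P" for k
      using fun_cong[OF conjunct1[OF L], of k] that by simp
    have "x j = b" using L P[OF assms(2)] by simp
    with P x show "x = (\<lambda>k\<in>insert j P. b)"
      by (intro extensionalityI[of _ "insert j P"]) (auto simp: labels_def PiE_def)
  next
    assume R: "x = (\<lambda>k\<in>insert j P. b)"
    show "restrict x P = (\<lambda>k\<in>P. b) \<and> x j = x i"
      unfolding R using assms(2) by (auto simp: restrict_def fun_eq_iff)
  qed
  have ket: "ket False (x j \<noteq> x i) = (if x j = x i then 1 else 0)"
    by (auto simp: ket_def)
  show "cnot i j (append_zero P j (tcss_share P q)) x = tcss_share (insert j P) q x"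
  proof (cases "x \<in> labels (insert j P)")
    case True
    have "cnot i j (append_zero P j (tcss_share P q)) x
        = tcss_share P q (restrict x P) * (if x j = x i then 1 else 0)"
      using True ij by (simp only: cnot_def append_zero_def mem res ket if_True fun_upd_same)
    also have "\<dots> = tcss_share (insert j P) q x"
      unfolding tcss_share_def tensor_power_ket[OF assms(1)]
        tensor_power_ket[OF finite.insertI[OF assms(1)]] eq[OF True, symmetric]
      by simp
    finally show ?thesis .
  next
    case False
    then show ?thesis
      by (simp add: cnot_def append_zero_def mem tcss_share_def tensor_power_def)
  qed
qed

lemma equator_qubit_orthonormal:
  "(\<Sum>d\<in>UNIV. equator_qubit \<phi> c d * cnj (equator_qubit \<phi> c' d)) = (if c = c' then 1 else 0)"
proof -
  have *: "complex_of_real (sqrt 2) * complex_of_real (sqrt 2) = 2"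
    by (simp flip: of_real_mult)
  have "cis \<phi> * cnj (cis \<phi>) = 1" by (simp add: cis_cnj cis_mult)
  then show ?thesis
    by (auto simp: UNIV_bool equator_qubit_def ket_def field_simps *)
qed

lemma tcss_share_equator_qubit:
  "tcss_share P (equator_qubit \<phi> c) x =
     complex_of_real (1 / sqrt 2) * tensor_power P (ket False) x
     + (if c then 1 else -1) * cis \<phi> * complex_of_real (1 / sqrt 2) * tensor_power P (ket True) x"
  by (simp add: tcss_share_def equator_qubit_def ket_def)

end

theory Submission
  imports Defs
begin

text \<open>
  Whenever a qubit \<open>j\<close> is traced out, only matrix entries between labels that agree at \<open>j\<close>
  contribute to the reduced state.  For such labels the cross terms between \<open>|0...0>\<close> and
  \<open>|1...1>\<close> vanish, and these are the only entries in which the sign encoding the bit survives.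
\<close>

lemma tensor_power_ket_eq_0:
  assumes "finite P" "j \<in> P" "x j \<noteq> b"
  shows "tensor_power P (ket b) x = 0"
  using assms by (auto simp: tensor_power_ket)

text \<open>Agreement at \<open>j\<close> kills the same one of the two branches in both labels. If
  the all-ones branch survives, its sign meets its own conjugate and squares to 1; the all-zeros
  branch carries no sign.\<close>

lemma projector_tcss_share_equator_qubit:
  assumes "finite P" "j \<in> P" "x j = y j"
  shows "projector (tcss_share P (equator_qubit \<phi> c)) x y
       = projector (tcss_share P (equator_qubit \<phi> c')) x y"
proof (cases "x j")
  case True
  then have "tensor_power P (ket False) x = 0" "tensor_power P (ket False) y = 0"
    using assms by (auto intro: tensor_power_ket_eq_0)
  then show ?thesis by (simp add: projector_def tcss_share_equator_qubit)
next
  case False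
  then have "tensor_power P (ket True) x = 0" "tensor_power P (ket True) y = 0"
    using assms by (auto intro: tensor_power_ket_eq_0)
  then show ?thesis by (simp add: projector_def tcss_share_equator_qubit)
qed

lemma perfect_bit_sharing_equator_qubit:
  assumes "finite P"
  shows "perfect_bit_sharing P (\<lambda>c. tcss_share P (equator_qubit \<phi> c))"
  unfolding perfect_bit_sharing_def
proof (intro allI impI)
  fix S assume "S \<subset> P"
  then obtain j where j: "j \<in> P" "j \<notin> S" by blast
  let ?m = "merge (P - (P - S)) (P - S)"
  \<comment> \<open>Since \<open>j\<close> is traced out, \<open>?m\<close> takes the value at
    \<open>j\<close> from the common \<open>z\<close>, so both merged labels agree there whatever
    \<open>x\<close> and \<open>y\<close> are.\<close>
  have "projector (tcss_share P (equator_qubit \<phi> False)) (?m (x, z)) (?m (y, z))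
      = projector (tcss_share P (equator_qubit \<phi> True)) (?m (x, z)) (?m (y, z))" for x y z
    using j by (intro projector_tcss_share_equator_qubit[OF assms j(1)]) (simp add: merge_def)
  then show "partial_trace P (P - S) (projector (tcss_share P (equator_qubit \<phi> False)))
      = partial_trace P (P - S) (projector (tcss_share P (equator_qubit \<phi> True)))"
    by (simp only: partial_trace_def)
qed

theorem theorem2:
  fixes \<phi> :: real and n :: nat
  assumes "0 \<le> \<phi>" and "\<phi> \<le> 2 * pi" and "n \<ge> 1"
  shows "perfect_bit_sharing {1..n} (\<lambda>c. tcss_share {1..n} (equator_qubit \<phi> c))"
  by (rule perfect_bit_sharing_equator_qubit) simp

end
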